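(* Let $\vartheta>1$, $\mu_k\ge0$, let $a_k,b_k\in\mathbb{R}^{n+1}$ be nonzero, and let $g_k=\nabla\Phi_\tau(z_k)$. Define $$A_k=a_k^TP_ka_k,\quad B_k=b_k^TP_k^{-1}b_k,\quad \Delta_k=a_k^Tb_k,\quad \chi_k=\frac{\Delta_k}{\sqrt{A_kB_k}},\quad \mathcal{D}_k=\Delta_k+\vartheta\sqrt{A_kB_k},$$ and consider $$d_k=-P_k^{-1}g_k+\left[\frac{g_k^TP_k^{-1}b_k}{\mathcal{D}_k}-\mu_k\frac{g_k^Ta_k}{A_k}\right]a_k-\frac{g_k^Ta_k}{\mathcal{D}_k}P_k^{-1}b_k.\qquad(\ast)$$ Then: (a) $\mathcal{D}_k\ge(\vartheta-1)\sqrt{A_kB_k}>0$; (b) $g_k^Td_k=-g_k^TP_k^{-1}g_k-\mu_k\frac{(g_k^Ta_k)^2}{A_k}$; (c) with $\widetilde b_k=b_k+\vartheta\sqrt{\frac{B_k}{A_k}}\,P_ka_k$ one has $d_k^T\widetilde b_k=-\Theta_k\,g_k^Ta_k$, where $$\Theta_k=\frac{\widetilde b_k^TP_k^{-1}\widetilde b_k}{a_k^T\widetilde b_k}+\mu_k\frac{a_k^T\widetilde b_k}{A_k}>0;$$ (d) with $\Gamma_0=\frac{\vartheta^2}{\vartheta^2-1}$, $\varpi_k^2=\frac{1-\chi_k^2}{(\vartheta+\chi_k)^2}$ and $\mu_k^\star=\frac{\Gamma_0-1-\varpi_k^2}{\sqrt{\Gamma_0}+1}$, every $0\le\mu_k\le\mu_k^\star$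 satisfies $d_k^TP_kd_k\le\Gamma_0\,g_k^TP_k^{-1}g_k$, and hence $-g_k^Td_k\ge(1-\vartheta^{-2})\,d_k^TP_kd_k$; (e) consequently, for $c_1,\rho\in(0,1)$ and $0\le\mu_k\le\mu_k^\star$: every $0<\alpha\le2(1-c_1)(1-\vartheta^{-2})$ satisfies the Armijo condition $\Phi_\tau(z_k+\alpha d_k)\le\Phi_\tau(z_k)+c_1\alpha g_k^Td_k$, and backtracking from $\alpha=1$ with factor $\rho$ accepts a step $\alpha_k\ge\rho\min\{1,2(1-c_1)(1-\vartheta^{-2})\}$, a bound independent of $\tau$; moreover, if $\tau>0$ is fixed, $\{z:\Phi_\tau(z)\le\Phi_\tau(z_0)\}$ is compact, and $(z_k)$ is an infinite sequence generated by $z_{k+1}=z_k+\alpha_kd_k$ with $g_k\ne0$, where $\alpha_k$ is obtained by this backtracking and each $d_k$ is either $-P_k^{-1}g_k$ (restart, in particular at $k=0$) or given by $(\ast)$ with nonzero $a_k,b_k$ and $0\le\mu_k\le\mu_k^\star$, then $\|\nabla\Phi_\tau(z_k)\|\to0$.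
   Context: Let $f_1,\dots,f_m\in C^1(\mathbb{R}^n)$ have gradients that are Lipschitz on $\mathbb{R}^n$ with constants $L_i\ge0$; $\bar L=\sum_i L_i$; $\tau>0$, $\delta>0$. Let $\phi_\tau(r)=\frac{r+\sqrt{r^2+\tau^2}}{2}$ and $\Phi_\tau(x,t)=t+\sum_{i=1}^m\phi_\tau(f_i(x)-t)$ on $\mathbb{R}^{n+1}$. At $z_k=(x_k,t_k)\in\mathbb{R}^{n+1}$ let $\omega_{i,k}=\sqrt{(f_i(x_k)-t_k)^2+\tau^2}$, $J_k$ the $m\times(n+1)$ matrix with rows $(\nabla f_i(x_k)^T,-1)$, $D_k=\operatorname{diag}(\omega_{1,k}^{-1},\dots,\omega_{m,k}^{-1})$, $\Pi_x=\operatorname{diag}(I_n,0)$, and $P_k=\delta I_{n+1}+\bar L\Pi_x+\frac12J_k^TD_kJ_k$, a symmetric positive definite matrix. *)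

theory Defs
  imports "HOL-Analysis.Analysis"
begin

definition grad :: "('a::real_inner \<Rightarrow> real) \<Rightarrow> 'a \<Rightarrow> 'a" where
  "grad f x = (THE D. GDERIV f x :> D)"

lemma grad_eqI:
  assumes "GDERIV f x :> D"
  shows "grad f x = D"
  unfolding grad_def
proof (rule the_equality)
  show "GDERIV f x :> D" by (rule assms)
next
  fix D' assume "GDERIV f x :> D'"
  with assms have "(\<lambda>h. h \<bullet> D) = (\<lambda>h. h \<bullet> D')"
    unfolding gderiv_def by (rule has_derivative_unique)
  then have "\<forall>h. h \<bullet> D' = h \<bullet> D"
    by (simp add: fun_eq_iff)
  then show "D' = D"
    by (simp only: vector_eq_ldot)
qed

definition C1_Lipschitz_grad :: "real \<Rightarrow> ('a::real_inner \<Rightarrow> real) \<Rightarrow> bool" where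
  "C1_Lipschitz_grad K f \<longleftrightarrow>
     (\<forall>x. f differentiable (at x)) \<and> continuous_on UNIV (grad f) \<and> K-lipschitz_on UNIV (grad f)"

text \<open>Vectors of dimension $n+1$ are indexed by \<^typ>\<open>'n option\<close>: a point $z = (x,t)$ has
  $x$ in the coordinates \<^term>\<open>Some i\<close> and $t$ in the coordinate \<^term>\<open>None\<close>.\<close>

definition xpart :: "real ^ 'n::finite option \<Rightarrow> real ^ 'n" where
  "xpart z = (\<chi> i. z $ Some i)"

definition tpart :: "real ^ 'n::finite option \<Rightarrow> real" where
  "tpart z = z $ None"

definition join :: "real ^ 'n::finite \<Rightarrow> real \<Rightarrow> real ^ 'n::finite option" where
  "join x t = (\<chi> j. case j of None \<Rightarrow> t | Some i \<Rightarrow> x $ i)"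

definition diag_mat :: "real ^ 'k \<Rightarrow> real ^ 'k ^ 'k" where
  "diag_mat v = (\<chi> i j. if i = j then v $ i else 0)"

definition phi :: "real \<Rightarrow> real \<Rightarrow> real" where
  "phi \<tau> r = (r + sqrt (r\<^sup>2 + \<tau>\<^sup>2)) / 2"

definition Phi :: "('m::finite \<Rightarrow> real ^ 'n::finite \<Rightarrow> real) \<Rightarrow> real \<Rightarrow> real ^ 'n::finite option \<Rightarrow> real" where
  "Phi f \<tau> z = tpart z + (\<Sum>i\<in>UNIV. phi \<tau> (f i (xpart z) - tpart z))"

definition omega :: "('m::finite \<Rightarrow> real ^ 'n::finite \<Rightarrow> real) \<Rightarrow> real \<Rightarrow> real ^ 'n::finite option \<Rightarrow> 'm \<Rightarrow> real" where
  "omega f \<tau> z i = sqrt ((f i (xpart z) - tpart z)\<^sup>2 + \<tau>\<^sup>2)"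

definition J_mat :: "('m::finite \<Rightarrow> real ^ 'n::finite \<Rightarrow> real) \<Rightarrow> real ^ 'n::finite option \<Rightarrow> real ^ 'n::finite option ^ 'm" where
  "J_mat f z = (\<chi> i. join (grad (f i) (xpart z)) (-1))"

definition D_mat :: "('m::finite \<Rightarrow> real ^ 'n::finite \<Rightarrow> real) \<Rightarrow> real \<Rightarrow> real ^ 'n::finite option \<Rightarrow> real ^ 'm ^ 'm" where
  "D_mat f \<tau> z = diag_mat (\<chi> i. inverse (omega f \<tau> z i))"

definition Pi_x :: "real ^ 'n::finite option ^ 'n option" where
  "Pi_x = diag_mat (join 1 0)"

definition P_mat :: "('m::finite \<Rightarrow> real ^ 'n::finite \<Rightarrow> real) \<Rightarrow> ('m \<Rightarrow> real) \<Rightarrow> real \<Rightarrow> real \<Rightarrow>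
    real ^ 'n::finite option \<Rightarrow> real ^ 'n::finite option ^ 'n option" where
  "P_mat f L \<tau> \<delta> z =
     \<delta> *\<^sub>R mat 1 + (\<Sum>i\<in>UNIV. L i) *\<^sub>R Pi_x
     + (1/2) *\<^sub>R (transpose (J_mat f z) ** D_mat f \<tau> z ** J_mat f z)"

definition A_of :: "real ^ 'k ^ 'k \<Rightarrow> real ^ 'k \<Rightarrow> real" where
  "A_of P a = a \<bullet> (P *v a)"

definition B_of :: "real ^ 'k ^ 'k \<Rightarrow> real ^ 'k \<Rightarrow> real" where
  "B_of P b = b \<bullet> (matrix_inv P *v b)"

definition chi :: "real ^ 'k ^ 'k \<Rightarrow> real ^ 'k \<Rightarrow> real ^ 'k \<Rightarrow> real" where
  "chi P a b = (a \<bullet> b) / sqrt (A_of P a * B_of P b)"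

definition calD :: "real \<Rightarrow> real ^ 'k ^ 'k \<Rightarrow> real ^ 'k \<Rightarrow> real ^ 'k \<Rightarrow> real" where
  "calD \<theta> P a b = a \<bullet> b + \<theta> * sqrt (A_of P a * B_of P b)"

definition restart_dir :: "real ^ 'k ^ 'k \<Rightarrow> real ^ 'k \<Rightarrow> real ^ 'k" where
  "restart_dir P g = - (matrix_inv P *v g)"

definition search_dir :: "real \<Rightarrow> real \<Rightarrow> real ^ 'k ^ 'k \<Rightarrow> real ^ 'k \<Rightarrow> real ^ 'k \<Rightarrow> real ^ 'k \<Rightarrow> real ^ 'k" where
  "search_dir \<theta> \<mu> P g a b =
     - (matrix_inv P *v g)
     + ((g \<bullet> (matrix_inv P *v b)) / calD \<theta> P a b - \<mu> * ((g \<bullet> a) / A_of P a)) *\<^sub>R a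
     - ((g \<bullet> a) / calD \<theta> P a b) *\<^sub>R (matrix_inv P *v b)"

definition b_tilde :: "real \<Rightarrow> real ^ 'k ^ 'k \<Rightarrow> real ^ 'k \<Rightarrow> real ^ 'k \<Rightarrow> real ^ 'k" where
  "b_tilde \<theta> P a b = b + (\<theta> * sqrt (B_of P b / A_of P a)) *\<^sub>R (P *v a)"

definition Theta :: "real \<Rightarrow> real \<Rightarrow> real ^ 'k ^ 'k \<Rightarrow> real ^ 'k \<Rightarrow> real ^ 'k \<Rightarrow> real" where
  "Theta \<theta> \<mu> P a b =
     (b_tilde \<theta> P a b \<bullet> (matrix_inv P *v b_tilde \<theta> P a b)) / (a \<bullet> b_tilde \<theta> P a b)
     + \<mu> * ((a \<bullet> b_tilde \<theta> P a b) / A_of P a)"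

definition Gamma0 :: "real \<Rightarrow> real" where
  "Gamma0 \<theta> = \<theta>\<^sup>2 / (\<theta>\<^sup>2 - 1)"

definition varpi_sq :: "real \<Rightarrow> real ^ 'k ^ 'k \<Rightarrow> real ^ 'k \<Rightarrow> real ^ 'k \<Rightarrow> real" where
  "varpi_sq \<theta> P a b = (1 - (chi P a b)\<^sup>2) / (\<theta> + chi P a b)\<^sup>2"

definition mu_star :: "real \<Rightarrow> real ^ 'k ^ 'k \<Rightarrow> real ^ 'k \<Rightarrow> real ^ 'k \<Rightarrow> real" where
  "mu_star \<theta> P a b = (Gamma0 \<theta> - 1 - varpi_sq \<theta> P a b) / (sqrt (Gamma0 \<theta>) + 1)"

definition armijo :: "('a::real_inner \<Rightarrow> real) \<Rightarrow> real \<Rightarrow> 'a \<Rightarrow> 'a \<Rightarrow> real \<Rightarrow> bool" where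
  "armijo F c\<^sub>1 z d \<alpha> \<longleftrightarrow> F (z + \<alpha> *\<^sub>R d) \<le> F z + c\<^sub>1 * \<alpha> * (grad F z \<bullet> d)"

text \<open>\<open>\<alpha>\<close> is the step accepted by backtracking: the first of the trial steps
  $1, \rho, \rho^2, \dots$ that satisfies the Armijo condition.\<close>

definition backtracking_step ::
    "('a::real_inner \<Rightarrow> real) \<Rightarrow> real \<Rightarrow> real \<Rightarrow> 'a \<Rightarrow> 'a \<Rightarrow> real \<Rightarrow> bool" where
  "backtracking_step F c\<^sub>1 \<rho> z d \<alpha> \<longleftrightarrow>
     (\<exists>j::nat. \<alpha> = \<rho> ^ j \<and> armijo F c\<^sub>1 z d (\<rho> ^ j) \<and> (\<forall>i<j. \<not> armijo F c\<^sub>1 z d (\<rho> ^ i)))"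

end

theory Submission
  imports Defs
begin

text \<open>
  Everything takes place in the inner product $\langle x, y\rangle = x^T P y$ of the metric
  $P = P_k$. Put $y = P^{-1} g$, and normalize $a$ and $P^{-1} b$ in this inner product to unit
  vectors $u$ and $v$; then $\langle u, v\rangle = \chi$. The direction becomes
  \[ d = -(I + S + \mu\, u u^*)\, y, \qquad S y = \frac{\langle y, u\rangle v - \langle y, v\rangle u}{\vartheta + \chi}, \]
  where $S$ is skew, of rank at most two and of norm $\varpi$. A skew map contributes nothing to
  $\langle y, d\rangle = g^T d$, so the descent of $d$ is that of the preconditioned gradient
  step, improved by the damping term in $\mu$. Replacing $b$ by $\widetilde b$ changes $P^{-1} b$
  only along $a$, which leaves the skew map as it is; this yields the product of $d$ and
  $\widetilde b$.
  For the energy $\langle d, d\rangle \le \Gamma_0 \langle y, y\rangle$ one has to see that a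
  quadratic form in two variables, the components of $y$ in the plane of $u$ and $v$, is positive
  semidefinite. With $\kappa = \Gamma_0 - 1 - \varpi^2$ its determinant is
  $(\kappa - \mu)^2 - \Gamma_0 \mu^2$, and $\mu \le \mu^\star$ says precisely that
  $\kappa - \mu \ge \sqrt{\Gamma_0}\, \mu$: this is \<open>damping_form_nonneg\<close>, which carries
  \<open>normalized_direction_bound\<close>.

  The matrix $P$ is the curvature of a quadratic majorant of $\Phi_\tau$ that touches it at $z$
  (\<open>Phi_quadratic_majorant\<close>). Concavity of the square root bounds $\phi_\tau$ by a parabola with
  second derivative $1/(2\omega)$, which gives the term $\frac12 J^T D J$; since $\phi_\tau$ is
  nondecreasing and 1-Lipschitz, the error $\frac12 L_i |p|^2$ of linearizing $f_i$ enters
  unamplified, which gives $\bar L\, \Pi_x$. Because of the energy bound, the majorant already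
  guarantees the Armijo condition for all steps up to $2(1-c_1)(1-\vartheta^{-2})$, whatever
  $\tau$ is, and backtracking from 1 stops at most a factor $\rho$ below this length (or at 1).

  For convergence, the values $\Phi_\tau(z_k)$ decrease and are bounded below, so that their
  decrements, which up to a constant factor dominate $-g_k^T d_k \ge g_k^T P_k^{-1} g_k$, tend to 0. On the compact
  sublevel set $P_k \le M I$ for some $M$ (which may depend on $\tau$), so
  $|g_k|^2 \le M\, g_k^T P_k^{-1} g_k$ tends to 0 as well.
\<close>

section \<open>The inner product of a positive definite matrix\<close>

text \<open>Symmetry is stated as self-adjointness because the matrices at hand are known through
  their bilinear forms, from which it can be read off.\<close>

definition sym_pos_def :: "real ^ 'k ^ 'k \<Rightarrow> bool" where
  "sym_pos_def P \<longleftrightarrow>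
     (\<forall>x y. x \<bullet> (P *v y) = y \<bullet> (P *v x)) \<and> (\<forall>v. v \<noteq> 0 \<longrightarrow> 0 < v \<bullet> (P *v v))"

lemma matrix_vector_mult_uminus: "A *v (- x) = - (A *v (x :: real ^ 'k))"
  by (simp add: matrix_vector_mult_def vec_eq_iff sum_negf)

lemmas quadratic_expand =
  inner_add_left inner_add_right inner_diff_left inner_diff_right
  matrix_vector_right_distrib matrix_vector_mult_diff_distrib matrix_vector_mult_scaleR
  matrix_vector_mult_uminus

lemma sym_pos_def_commute:
  assumes "sym_pos_def P"
  shows "x \<bullet> (P *v y) = y \<bullet> (P *v x)"
  using assms by (simp add: sym_pos_def_def)

lemma sym_pos_def_nonneg: "sym_pos_def P \<Longrightarrow> 0 \<le> v \<bullet> (P *v v)"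
  by (cases "v = 0") (auto simp: sym_pos_def_def less_imp_le)

text \<open>The usual argument: the form is nonnegative at the rescaled projection residual
  \<open>Y x - s y\<close>, where \<open>s\<close> and \<open>Y\<close> are the products of \<open>x\<close> and \<open>y\<close> with \<open>y\<close>.\<close>

lemma sym_pos_def_Cauchy_Schwarz:
  assumes P: "sym_pos_def P"
  shows "(x \<bullet> (P *v y))\<^sup>2 \<le> (x \<bullet> (P *v x)) * (y \<bullet> (P *v y))"
proof (cases "y = 0")
  case True
  then show ?thesis by simp
next
  case False
  define X s Y where "X = x \<bullet> (P *v x)" and "s = x \<bullet> (P *v y)" and "Y = y \<bullet> (P *v y)"
  have Y: "0 < Y" using P False by (simp add: sym_pos_def_def Y_def)
  have s: "y \<bullet> (P *v x) = s" using sym_pos_def_commute[OF P] by (simp add: s_def)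
  have "0 \<le> (Y *\<^sub>R x - s *\<^sub>R y) \<bullet> (P *v (Y *\<^sub>R x - s *\<^sub>R y))"
    by (rule sym_pos_def_nonneg[OF P])
  also have "\<dots> = Y * (X * Y - s\<^sup>2)"
    by (simp add: quadratic_expand s flip: X_def s_def Y_def)
       (simp add: algebra_simps power2_eq_square)
  finally have "s\<^sup>2 \<le> X * Y" using Y by (simp add: zero_le_mult_iff)
  then show ?thesis by (simp add: X_def s_def Y_def)
qed

lemma sym_pos_def_matrix_inv:
  fixes P :: "real ^ 'k ^ 'k"
  assumes P: "sym_pos_def P"
  shows "P *v (matrix_inv P *v x) = x" and "matrix_inv P *v (P *v x) = x"
proof -
  have "x = 0" if "P *v x = 0" for x
  proof (rule ccontr)
    assume "x \<noteq> 0"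
    with P have "0 < x \<bullet> (P *v x)" by (simp add: sym_pos_def_def)
    with that show False by simp
  qed
  then have "\<exists>B. B ** P = mat 1" by (simp add: matrix_left_invertible_ker)
  then have "\<exists>B. P ** B = mat 1 \<and> B ** P = mat 1"
    using matrix_left_right_inverse by blast
  then have "P ** matrix_inv P = mat 1 \<and> matrix_inv P ** P = mat 1"
    unfolding matrix_inv_def by (rule someI_ex)
  then show "P *v (matrix_inv P *v x) = x" "matrix_inv P *v (P *v x) = x"
    by (simp_all add: matrix_vector_mul_assoc)
qed

lemma sym_pos_def_inv_pos:
  assumes P: "sym_pos_def P" and "b \<noteq> 0"
  shows "0 < b \<bullet> (matrix_inv P *v b)"
proof -
  have "matrix_inv P *v b \<noteq> 0"
    using sym_pos_def_matrix_inv(1)[OF P, of b] \<open>b \<noteq> 0\<close> by force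
  with P have "0 < (matrix_inv P *v b) \<bullet> (P *v (matrix_inv P *v b))"
    by (simp add: sym_pos_def_def)
  then show ?thesis by (simp add: sym_pos_def_matrix_inv[OF P] inner_commute)
qed

lemma sym_pos_def_inv_commute:
  assumes P: "sym_pos_def P"
  shows "x \<bullet> (matrix_inv P *v y) = y \<bullet> (matrix_inv P *v x)"
  using sym_pos_def_commute[OF P, of "matrix_inv P *v x" "matrix_inv P *v y"]
  by (simp add: sym_pos_def_matrix_inv[OF P] inner_commute)

text \<open>Cauchy-Schwarz for \<open>a\<close> and \<open>matrix_inv P *v b\<close>, whose product in the metric is \<open>a \<bullet> b\<close>. It says
  that \<open>chi P a b\<close> lies between -1 and 1, which keeps \<open>calD\<close> away from zero.\<close>

lemma sym_pos_def_dual_Cauchy_Schwarz: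
  assumes P: "sym_pos_def P"
  shows "\<bar>a \<bullet> b\<bar> \<le> sqrt (A_of P a * B_of P b)"
proof (rule real_le_rsqrt)
  have "(a \<bullet> (P *v (matrix_inv P *v b)))\<^sup>2
      \<le> (a \<bullet> (P *v a)) * ((matrix_inv P *v b) \<bullet> (P *v (matrix_inv P *v b)))"
    by (rule sym_pos_def_Cauchy_Schwarz[OF P])
  then show "\<bar>a \<bullet> b\<bar>\<^sup>2 \<le> A_of P a * B_of P b"
    by (simp add: sym_pos_def_matrix_inv[OF P] A_of_def B_of_def inner_commute)
qed

text \<open>An upper bound \<open>M\<close> on a metric is a lower bound \<open>1 / M\<close> on its inverse: write
  \<open>g \<bullet> g\<close> as the product of \<open>g\<close> and \<open>matrix_inv P *v g\<close> in the metric and use Cauchy-Schwarz.\<close>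

lemma sym_pos_def_inv_lower_bound:
  assumes P: "sym_pos_def P" and M: "\<And>v. v \<bullet> (P *v v) \<le> M * (v \<bullet> v)"
  shows "g \<bullet> g \<le> M * (g \<bullet> (matrix_inv P *v g))"
proof (cases "g = 0")
  case True
  then show ?thesis by simp
next
  case False
  have G: "0 \<le> g \<bullet> (matrix_inv P *v g)"
    using sym_pos_def_inv_pos[OF P False] by simp
  have "(g \<bullet> (P *v (matrix_inv P *v g)))\<^sup>2
      \<le> (g \<bullet> (P *v g)) * ((matrix_inv P *v g) \<bullet> (P *v (matrix_inv P *v g)))"
    by (rule sym_pos_def_Cauchy_Schwarz[OF P])
  then have "(g \<bullet> g)\<^sup>2 \<le> (g \<bullet> (P *v g)) * (g \<bullet> (matrix_inv P *v g))"
    by (simp add: sym_pos_def_matrix_inv[OF P] inner_commute)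
  also have "\<dots> \<le> (M * (g \<bullet> g)) * (g \<bullet> (matrix_inv P *v g))"
    by (intro mult_right_mono M G)
  finally have "(g \<bullet> g) * (g \<bullet> g) \<le> (g \<bullet> g) * (M * (g \<bullet> (matrix_inv P *v g)))"
    by (simp add: power2_eq_square algebra_simps)
  then show ?thesis using False by simp
qed

section \<open>The search direction\<close>

lemma calD_lower_bound:
  assumes P: "sym_pos_def P" and "a \<noteq> 0" "b \<noteq> 0" "\<theta> > 1"
  shows "calD \<theta> P a b \<ge> (\<theta> - 1) * sqrt (A_of P a * B_of P b)"
    and "(\<theta> - 1) * sqrt (A_of P a * B_of P b) > 0"
proof -
  show "(\<theta> - 1) * sqrt (A_of P a * B_of P b) > 0"
    using assms sym_pos_def_inv_pos[OF P] by (auto simp: A_of_def B_of_def sym_pos_def_def)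
  show "calD \<theta> P a b \<ge> (\<theta> - 1) * sqrt (A_of P a * B_of P b)"
    using sym_pos_def_dual_Cauchy_Schwarz[OF P, of a b] by (simp add: calD_def algebra_simps)
qed

text \<open>The two terms with denominator \<open>calD\<close> are antisymmetric in \<open>a\<close> and
  \<open>matrix_inv P *v b\<close>, so their products with \<open>g\<close> cancel and only the damping term survives.\<close>

lemma grad_inner_search_dir:
  "g \<bullet> search_dir \<theta> \<mu> P g a b
     = - (g \<bullet> (matrix_inv P *v g)) - \<mu> * ((g \<bullet> a)\<^sup>2 / A_of P a)"
  by (simp add: search_dir_def quadratic_expand power2_eq_square)
     (simp add: algebra_simps)

text \<open>The direction keeps its form if \<open>b\<close> is replaced by \<open>b_tilde\<close>, because \<open>b_tilde\<close>
  adds to \<open>matrix_inv P *v b\<close> only a multiple of \<open>a\<close>, which drops out of the skew map. Moreover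
  the denominator \<open>calD\<close> is just the product of \<open>a\<close> and \<open>b_tilde\<close>. Hence the
  two terms in \<open>g \<bullet> (matrix_inv P *v b_tilde)\<close> cancel, and what remains is a multiple of \<open>g \<bullet> a\<close>.\<close>

lemma search_dir_quasi_conjugacy:
  assumes P: "sym_pos_def P" and a: "a \<noteq> 0" and b: "b \<noteq> 0" and th: "\<theta> > 1" and mu: "\<mu> \<ge> 0"
  shows "search_dir \<theta> \<mu> P g a b \<bullet> b_tilde \<theta> P a b = - Theta \<theta> \<mu> P a b * (g \<bullet> a)"
    and "Theta \<theta> \<mu> P a b > 0"
proof -
  define A B D s bt where "A = A_of P a" and "B = B_of P b" and "D = calD \<theta> P a b"
    and "s = \<theta> * sqrt (B / A)" and "bt = b_tilde \<theta> P a b"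
  have A: "A > 0" and B: "B > 0"
    using a b P sym_pos_def_inv_pos[OF P] by (auto simp: A_def B_def A_of_def B_of_def sym_pos_def_def)
  have D: "D > 0" using calD_lower_bound[OF P a b th] by (simp add: D_def)
  have bt: "bt = b + s *\<^sub>R (P *v a)"
    by (simp add: bt_def b_tilde_def s_def A_def B_def)
  have inv_bt: "matrix_inv P *v bt = matrix_inv P *v b + s *\<^sub>R a"
    by (simp add: bt quadratic_expand sym_pos_def_matrix_inv[OF P])
  have "sqrt (B / A) * A = sqrt (A * B)"
    using A B by (simp add: real_sqrt_divide real_sqrt_mult field_simps)
  then have a_bt: "a \<bullet> bt = D"
    by (simp add: bt quadratic_expand D_def calD_def s_def
             flip: A_of_def A_def B_def) 
  then have "bt \<noteq> 0" using D by auto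
  then have C: "0 < bt \<bullet> (matrix_inv P *v bt)" by (rule sym_pos_def_inv_pos[OF P])
  \<comment> \<open>The multiples of \<open>a\<close> introduced when \<open>b\<close> is replaced by \<open>bt\<close> cancel.\<close>
  have "search_dir \<theta> \<mu> P g a b
      = - (matrix_inv P *v g) + ((g \<bullet> (matrix_inv P *v bt)) / D - \<mu> * ((g \<bullet> a) / A)) *\<^sub>R a
        - ((g \<bullet> a) / D) *\<^sub>R (matrix_inv P *v bt)"
    unfolding search_dir_def inv_bt using D
    by (simp add: quadratic_expand add_divide_distrib algebra_simps flip: D_def A_def)
  then have "search_dir \<theta> \<mu> P g a b \<bullet> bt
      = - (g \<bullet> (matrix_inv P *v bt)) + ((g \<bullet> (matrix_inv P *v bt)) / D - \<mu> * ((g \<bullet> a) / A)) * D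
        - ((g \<bullet> a) / D) * (bt \<bullet> (matrix_inv P *v bt))"
    using sym_pos_def_inv_commute[OF P, of g bt]
    by (simp add: quadratic_expand a_bt inner_commute)
  also have "\<dots> = - ((bt \<bullet> (matrix_inv P *v bt)) / D + \<mu> * (D / A)) * (g \<bullet> a)"
    using D by (simp add: field_simps)
  also have "\<dots> = - Theta \<theta> \<mu> P a b * (g \<bullet> a)"
    by (simp add: Theta_def a_bt flip: bt_def A_def)
  finally show "search_dir \<theta> \<mu> P g a b \<bullet> b_tilde \<theta> P a b = - Theta \<theta> \<mu> P a b * (g \<bullet> a)"
    by (simp add: bt_def)
  have "Theta \<theta> \<mu> P a b = (bt \<bullet> (matrix_inv P *v bt)) / D + \<mu> * (D / A)"
    by (simp add: Theta_def a_bt flip: bt_def A_def)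
  also have "\<dots> > 0" using A C D mu by (intro add_pos_nonneg) auto
  finally show "Theta \<theta> \<mu> P a b > 0" .
qed

text \<open>The upper bound on the damping enters here. Replacing \<open>t\<close> by its worst case
  \<open>\<plusminus> w sqrt H\<close> leaves a quadratic form in \<open>sqrt H\<close> and \<open>p\<close> with leading coefficient \<open>\<kappa>\<close>
  and determinant \<open>(\<kappa> - \<mu>)\<^sup>2 - \<Gamma> \<mu>\<^sup>2\<close>, which is nonnegative exactly because
  \<open>\<mu> (sqrt \<Gamma> + 1) \<le> \<kappa>\<close>.\<close>

lemma damping_form_nonneg:
  fixes H p t w \<mu> \<Gamma> \<kappa> :: real
  assumes H: "0 \<le> H" and w: "0 \<le> w" and t: "t\<^sup>2 \<le> w\<^sup>2 * H" and mu: "0 \<le> \<mu>" and G: "1 \<le> \<Gamma>"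
    and kappa: "\<kappa> = \<Gamma> - 1 - w\<^sup>2" and le: "\<mu> * (sqrt \<Gamma> + 1) \<le> \<kappa>"
  shows "0 \<le> \<kappa> * H + (\<kappa> - 2 * \<mu> - \<mu>\<^sup>2) * p\<^sup>2 + 2 * \<mu> * p * t"
proof -
  have sG: "0 \<le> sqrt \<Gamma>" "(sqrt \<Gamma>)\<^sup>2 = \<Gamma>" using G by auto
  have k0: "0 \<le> \<kappa>" using le mu sG by (meson add_nonneg_nonneg mult_nonneg_nonneg order_trans zero_le_one)
  show ?thesis
  proof (cases "\<kappa> = 0")
    case True
    have "\<mu> \<le> \<mu> * (sqrt \<Gamma> + 1)" using mu sG by (simp add: algebra_simps)
    then have "\<mu> = 0" using le True mu by linarith
    then show ?thesis using True by simp
  next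
    case False
    then have k: "0 < \<kappa>" using k0 by simp
    have "(\<mu> * sqrt \<Gamma>)\<^sup>2 \<le> (\<kappa> - \<mu>)\<^sup>2"
      by (rule power_mono) (use le mu sG in \<open>auto simp: algebra_simps\<close>)
    then have "\<mu>\<^sup>2 * \<Gamma> \<le> (\<kappa> - \<mu>)\<^sup>2" using sG by (simp add: power_mult_distrib)
    then have det: "\<mu>\<^sup>2 * w\<^sup>2 \<le> \<kappa> * (\<kappa> - 2 * \<mu> - \<mu>\<^sup>2)"
      unfolding power2_eq_square kappa by (simp add: algebra_simps)
    have "\<bar>t\<bar> \<le> sqrt (w\<^sup>2 * H)" using t by (intro real_le_rsqrt) simp
    then have t': "\<bar>t\<bar> \<le> w * sqrt H" using w by (simp add: real_sqrt_mult)
    have "- (p * t) \<le> \<bar>p\<bar> * \<bar>t\<bar>" by (metis abs_ge_minus_self abs_mult)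
    also have "\<dots> \<le> \<bar>p\<bar> * (w * sqrt H)" using t' by (intro mult_left_mono) auto
    finally have pt: "- (p * t) \<le> \<bar>p\<bar> * (w * sqrt H)" .
    \<comment> \<open>A completed square, to be compared with \<open>\<kappa>\<close> times the form.\<close>
    have "0 \<le> (\<kappa> * sqrt H - \<mu> * w * \<bar>p\<bar>)\<^sup>2" by simp
    also have "\<dots> = \<kappa>\<^sup>2 * H + \<mu>\<^sup>2 * w\<^sup>2 * p\<^sup>2 - 2 * \<kappa> * \<mu> * (\<bar>p\<bar> * (w * sqrt H))"
      using H by (simp add: power2_diff power_mult_distrib)
    also have "\<dots> \<le> \<kappa>\<^sup>2 * H + \<kappa> * (\<kappa> - 2 * \<mu> - \<mu>\<^sup>2) * p\<^sup>2 - 2 * \<kappa> * \<mu> * (- (p * t))"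
      by (intro diff_mono add_mono mult_left_mono mult_right_mono det pt) (use k mu in auto)
    also have "\<dots> = \<kappa> * (\<kappa> * H + (\<kappa> - 2 * \<mu> - \<mu>\<^sup>2) * p\<^sup>2 + 2 * \<mu> * p * t)"
      by (simp add: algebra_simps power2_eq_square)
    finally show ?thesis using k by (simp add: zero_le_mult_iff)
  qed
qed

lemma Gamma0_gt_1: "1 < \<theta> \<Longrightarrow> 1 < Gamma0 \<theta>"
  by (simp add: Gamma0_def field_simps one_less_power)

text \<open>Apart from the length of \<open>y\<close>, the energy of \<open>d\<close> depends only on \<open>p\<close>, the component of \<open>y\<close> along \<open>u\<close>, and on \<open>t\<close>, the
  component along the unit vector orthogonal to \<open>u\<close> in the plane of \<open>u\<close> and \<open>v\<close>, scaled by the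
  norm \<open>w\<close> of the skew map. Working with \<open>t\<close> instead of that unit vector avoids a separate
  treatment of parallel \<open>u\<close> and \<open>v\<close>, where the unit vector does not exist but \<open>t = 0\<close>.\<close>

lemma normalized_direction_bound:
  fixes P :: "real ^ 'k ^ 'k"
  assumes P: "sym_pos_def P"
    and u: "u \<bullet> (P *v u) = 1" and v: "v \<bullet> (P *v v) = 1" and X: "u \<bullet> (P *v v) = X"
    and th: "\<theta> > 1" and mu: "0 \<le> \<mu>"
    and le: "\<mu> * (sqrt (Gamma0 \<theta>) + 1) \<le> Gamma0 \<theta> - 1 - (1 - X\<^sup>2) / (\<theta> + X)\<^sup>2"
    and d: "d = - y + ((y \<bullet> (P *v v)) / (\<theta> + X) - \<mu> * (y \<bullet> (P *v u))) *\<^sub>R u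
                 - ((y \<bullet> (P *v u)) / (\<theta> + X)) *\<^sub>R v"
  shows "d \<bullet> (P *v d) \<le> Gamma0 \<theta> * (y \<bullet> (P *v y))"
proof -
  define G p r where "G = y \<bullet> (P *v y)" and "p = y \<bullet> (P *v u)" and "r = y \<bullet> (P *v v)"
  note sym = sym_pos_def_commute[OF P]
  have sym': "u \<bullet> (P *v y) = p" "v \<bullet> (P *v y) = r" "v \<bullet> (P *v u) = X"
    using sym X by (simp_all add: p_def r_def)
  have "X\<^sup>2 \<le> 1" using sym_pos_def_Cauchy_Schwarz[OF P, of u v] u v X by simp
  then have "\<bar>X\<bar> \<le> 1" by (simp add: abs_square_le_1)
  then have D: "0 < \<theta> + X" using th by linarith
  have pG: "p\<^sup>2 \<le> G" using sym_pos_def_Cauchy_Schwarz[OF P, of y u] u by (simp add: p_def G_def)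
  define w t where "w = sqrt ((1 - X\<^sup>2) / (\<theta> + X)\<^sup>2)" and "t = (r - X * p) / (\<theta> + X)"
  have w: "0 \<le> w" "w\<^sup>2 = (1 - X\<^sup>2) / (\<theta> + X)\<^sup>2" using \<open>X\<^sup>2 \<le> 1\<close> by (auto simp: w_def)
  \<comment> \<open>Gram determinant of \<open>y\<close>, \<open>u\<close>, \<open>v\<close>, as Cauchy-Schwarz for the parts orthogonal to \<open>u\<close>.\<close>
  have "((y - p *\<^sub>R u) \<bullet> (P *v (v - X *\<^sub>R u)))\<^sup>2
      \<le> ((y - p *\<^sub>R u) \<bullet> (P *v (y - p *\<^sub>R u))) * ((v - X *\<^sub>R u) \<bullet> (P *v (v - X *\<^sub>R u)))"
    by (rule sym_pos_def_Cauchy_Schwarz[OF P])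
  then have "(r - X * p)\<^sup>2 \<le> (G - p\<^sup>2) * (1 - X\<^sup>2)"
    by (simp add: quadratic_expand u v X sym' flip: p_def r_def G_def)
       (simp add: algebra_simps power2_eq_square)
  then have t: "t\<^sup>2 \<le> w\<^sup>2 * (G - p\<^sup>2)"
    using D by (simp add: t_def w power_divide divide_right_mono mult.commute)
  define k where "k = Gamma0 \<theta> - 1 - w\<^sup>2"
  have key: "0 \<le> k * (G - p\<^sup>2) + (k - 2 * \<mu> - \<mu>\<^sup>2) * p\<^sup>2 + 2 * \<mu> * p * t"
    by (rule damping_form_nonneg[where w = w and \<Gamma> = "Gamma0 \<theta>"])
       (use pG w t mu Gamma0_gt_1[OF th] le in \<open>auto simp: k_def\<close>)
  define q s where "q = p / (\<theta> + X)" and "s = r / (\<theta> + X)"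
  have st: "t = s - X * q" by (simp add: t_def s_def q_def diff_divide_distrib)
  have wq: "w\<^sup>2 * p\<^sup>2 = (1 - X\<^sup>2) * q\<^sup>2" by (simp add: w q_def power_divide)
  have qr: "q * r = p * s" by (simp add: q_def s_def)
  have "d \<bullet> (P *v d) = G + (s - \<mu> * p)\<^sup>2 + q\<^sup>2 - 2 * (s - \<mu> * p) * p + 2 * (q * r) - 2 * (s - \<mu> * p) * q * X"
    unfolding d by (simp add: quadratic_expand u v X sym' flip: p_def r_def G_def q_def s_def)
      (simp add: algebra_simps power2_eq_square)
  also have "\<dots> = G + (2 * \<mu> + \<mu>\<^sup>2) * p\<^sup>2 + w\<^sup>2 * p\<^sup>2 - 2 * \<mu> * p * t + t\<^sup>2"
    unfolding wq qr st by (simp add: algebra_simps power2_eq_square)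
  finally have "d \<bullet> (P *v d) = G + (2 * \<mu> + \<mu>\<^sup>2 + w\<^sup>2) * p\<^sup>2 - 2 * \<mu> * p * t + t\<^sup>2"
    by (simp add: algebra_simps)
  then have "d \<bullet> (P *v d) \<le> Gamma0 \<theta> * G"
    using t key by (simp add: k_def algebra_simps)
  then show ?thesis by (simp add: G_def)
qed

text \<open>Reduction to unit vectors: \<open>a\<close> and \<open>c\<close>, the image of \<open>b\<close> under \<open>matrix_inv P\<close>, have
  squared lengths \<open>A\<close> and \<open>B\<close> in the metric of \<open>P\<close>, and their cosine is \<open>chi P a b\<close>.\<close>

lemma search_dir_energy_bound:
  assumes P: "sym_pos_def P" and a: "a \<noteq> 0" and b: "b \<noteq> 0" and th: "\<theta> > 1"
    and mu: "0 \<le> \<mu>" "\<mu> \<le> mu_star \<theta> P a b" and d: "d = search_dir \<theta> \<mu> P g a b"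
  shows "d \<bullet> (P *v d) \<le> Gamma0 \<theta> * (g \<bullet> (matrix_inv P *v g))"
proof -
  note inv = sym_pos_def_matrix_inv[OF P]
  define A B where "A = A_of P a" and "B = B_of P b"
  define y c u v X where "y = matrix_inv P *v g" and "c = matrix_inv P *v b"
    and "u = (1 / sqrt A) *\<^sub>R a" and "v = (1 / sqrt B) *\<^sub>R c" and "X = chi P a b"
  have A: "A > 0" and B: "B > 0"
    using a b P sym_pos_def_inv_pos[OF P] by (auto simp: A_def B_def A_of_def B_of_def sym_pos_def_def)
  have ya: "y \<bullet> (P *v a) = g \<bullet> a"
    using sym_pos_def_commute[OF P, of y a] inv by (simp add: y_def inner_commute)
  have yc: "y \<bullet> (P *v c) = g \<bullet> c"
    using sym_pos_def_inv_commute[OF P, of b g] inv by (simp add: y_def c_def inner_commute)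
  have u: "u \<bullet> (P *v u) = 1"
    using A by (simp add: u_def quadratic_expand flip: A_of_def A_def)
  have "c \<bullet> (P *v c) = B" by (simp add: c_def inv B_def B_of_def inner_commute)
  then have v: "v \<bullet> (P *v v) = 1" using B by (simp add: v_def quadratic_expand)
  have X: "u \<bullet> (P *v v) = X"
    using A B by (simp add: u_def v_def c_def quadratic_expand inv X_def chi_def real_sqrt_mult
        flip: A_def B_def)
  have D: "calD \<theta> P a b = sqrt A * sqrt B * (\<theta> + X)"
    using A B by (simp add: calD_def X_def chi_def real_sqrt_mult field_simps flip: A_def B_def)
  have "\<bar>X\<bar> \<le> 1"
    using sym_pos_def_Cauchy_Schwarz[OF P, of u v] u v X by (simp add: abs_square_le_1)
  then have tX: "\<theta> + X > 0" using th by linarith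
  have sq: "sqrt A * sqrt A = A" "sqrt B * sqrt B = B" using A B by auto
  have yu: "y \<bullet> (P *v u) = (g \<bullet> a) / sqrt A" by (simp add: u_def quadratic_expand ya)
  have yv: "y \<bullet> (P *v v) = (g \<bullet> c) / sqrt B" by (simp add: v_def quadratic_expand yc)
  have "d = - y + ((g \<bullet> c) / (sqrt A * sqrt B * (\<theta> + X)) - \<mu> * ((g \<bullet> a) / (sqrt A * sqrt A))) *\<^sub>R a
         - ((g \<bullet> a) / (sqrt A * sqrt B * (\<theta> + X))) *\<^sub>R c"
    unfolding d search_dir_def by (simp only: D sq(1) y_def c_def flip: A_def)
  also have "\<dots> = - y + ((y \<bullet> (P *v v)) / (\<theta> + X) - \<mu> * (y \<bullet> (P *v u))) *\<^sub>R u
                 - ((y \<bullet> (P *v u)) / (\<theta> + X)) *\<^sub>R v"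
    unfolding yu yv by (simp add: u_def v_def diff_divide_distrib mult_ac)
  finally have d': "d = \<dots>" .
  have "\<mu> * (sqrt (Gamma0 \<theta>) + 1) \<le> Gamma0 \<theta> - 1 - (1 - X\<^sup>2) / (\<theta> + X)\<^sup>2"
  proof -
    have "0 < sqrt (Gamma0 \<theta>) + 1"
      using Gamma0_gt_1[OF th] by (simp add: add_nonneg_pos)
    then show ?thesis using mu(2) by (simp add: mu_star_def varpi_sq_def X_def pos_le_divide_eq)
  qed
  from normalized_direction_bound[OF P u v X th mu(1) this d']
  show ?thesis by (simp add: y_def inv inner_commute)
qed

section \<open>The quadratic majorant of the smoothed objective\<close>

text \<open>The Riesz representative of the derivative, which exists because the space is
  finite-dimensional, is the value chosen by \<open>grad\<close>.\<close>

lemma GDERIV_grad: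
  fixes f :: "'a::euclidean_space \<Rightarrow> real"
  assumes "f differentiable (at x)"
  shows "GDERIV f x :> grad f x"
proof -
  obtain f' where f': "(f has_derivative f') (at x)"
    using assms by (auto simp: differentiable_def)
  then have "linear f'" by (simp add: has_derivative_linear)
  then have "f' = (\<lambda>h. h \<bullet> adjoint f' 1)" by (simp add: adjoint_works)
  with f' have "GDERIV f x :> adjoint f' 1" by (simp add: gderiv_def)
  then show ?thesis by (simp add: grad_eqI)
qed

text \<open>Along the segment from \<open>x\<close> to \<open>x + p\<close> the gap between \<open>f\<close> and the upper bound, which
  is \<open>h\<close> up to a constant, has derivative \<open>(grad f (x + s p) - grad f x) \<bullet> p - K s (p \<bullet> p)\<close>, which is nonpositive
  by the Lipschitz condition.\<close>

lemma Lipschitz_grad_quadratic_upper_bound: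
  fixes f :: "'a::euclidean_space \<Rightarrow> real"
  assumes f: "C1_Lipschitz_grad K f"
  shows "f (x + p) \<le> f x + grad f x \<bullet> p + K / 2 * (p \<bullet> p)"
proof -
  define h where "h s = f (x + s *\<^sub>R p) - s * (grad f x \<bullet> p) - K / 2 * s\<^sup>2 * (p \<bullet> p)" for s
  have "h 1 \<le> h 0"
  proof (rule DERIV_nonpos_imp_nonincreasing[of 0 1 h])
    fix s :: real assume s: "0 \<le> s" "s \<le> 1"
    let ?y = "x + s *\<^sub>R p"
    have "(f has_derivative (\<lambda>h. h \<bullet> grad f ?y)) (at ?y)"
      using GDERIV_grad[of f ?y] f by (simp add: C1_Lipschitz_grad_def gderiv_def)
    moreover have "((\<lambda>s. x + s *\<^sub>R p) has_derivative (\<lambda>h. h *\<^sub>R p)) (at s)"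
      by (auto intro!: derivative_eq_intros)
    ultimately have "((\<lambda>s. f (x + s *\<^sub>R p)) has_derivative (\<lambda>h. (h *\<^sub>R p) \<bullet> grad f ?y)) (at s)"
      using has_derivative_compose by blast
    then have "((\<lambda>s. f (x + s *\<^sub>R p)) has_real_derivative (grad f ?y \<bullet> p)) (at s)"
      by (rule has_derivative_imp_has_field_derivative) (simp add: inner_commute)
    then have "(h has_real_derivative (grad f ?y \<bullet> p - grad f x \<bullet> p - K * s * (p \<bullet> p))) (at s)"
      unfolding h_def by (auto intro!: derivative_eq_intros)
    moreover have "grad f ?y \<bullet> p - grad f x \<bullet> p - K * s * (p \<bullet> p) \<le> 0"
    proof -
      have "(grad f ?y - grad f x) \<bullet> p \<le> norm (grad f ?y - grad f x) * norm p"
        by (rule norm_cauchy_schwarz)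
      also have "\<dots> \<le> K * norm (s *\<^sub>R p) * norm p"
        using f lipschitz_onD[of K UNIV "grad f" ?y x]
        by (intro mult_right_mono) (auto simp: C1_Lipschitz_grad_def dist_norm)
      also have "\<dots> = K * s * (p \<bullet> p)"
        using s by (simp add: power2_norm_eq_inner[symmetric] power2_eq_square)
      finally show "grad f ?y \<bullet> p - grad f x \<bullet> p - K * s * (p \<bullet> p) \<le> 0"
        by (simp add: inner_diff_left)
    qed
    ultimately show "\<exists>y. (h has_real_derivative y) (at s) \<and> y \<le> 0" by blast
  qed simp
  then show ?thesis by (simp add: h_def)
qed

lemma sqrt_smoothing_bounds:
  fixes r \<tau> :: real
  assumes "\<tau> > 0"
  shows "\<tau> \<le> sqrt (r\<^sup>2 + \<tau>\<^sup>2)" and "0 < sqrt (r\<^sup>2 + \<tau>\<^sup>2)"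
proof -
  show "\<tau> \<le> sqrt (r\<^sup>2 + \<tau>\<^sup>2)" by (rule real_le_rsqrt) simp
  then show "0 < sqrt (r\<^sup>2 + \<tau>\<^sup>2)" using assms by linarith
qed

text \<open>The function \<open>phi \<tau>\<close> is nondecreasing and 1-Lipschitz, since \<open>sqrt (r\<^sup>2 + \<tau>\<^sup>2)\<close> is the
  modulus of \<open>Complex r \<tau>\<close>, hence 1-Lipschitz in \<open>r\<close>. An upper error in the argument
  therefore passes through \<open>phi \<tau>\<close> without growing.\<close>

lemma phi_le_add:
  assumes "r \<le> l + e" and "0 \<le> e"
  shows "phi \<tau> r \<le> phi \<tau> l + e"
proof -
  have "\<bar>sqrt (r\<^sup>2 + \<tau>\<^sup>2) - sqrt (l\<^sup>2 + \<tau>\<^sup>2)\<bar> \<le> \<bar>r - l\<bar>"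
  proof -
    have "Complex r \<tau> - Complex l \<tau> = complex_of_real (r - l)" by (simp add: complex_eq_iff)
    then have "cmod (Complex r \<tau> - Complex l \<tau>) = \<bar>r - l\<bar>" by (simp only: norm_of_real)
    with norm_triangle_ineq3[of "Complex r \<tau>" "Complex l \<tau>"] show ?thesis
      by (simp add: complex_norm)
  qed
  then show ?thesis using assms by (simp add: phi_def field_simps)
qed

text \<open>The square root lies below its tangent at \<open>w\<^sup>2 = r\<^sup>2 + \<tau>\<^sup>2\<close>, that is
  \<open>2 w w' \<le> w\<^sup>2 + w'\<^sup>2\<close>, and \<open>w'\<^sup>2\<close> is quadratic in \<open>s\<close>. The resulting curvature
  \<open>1 / (2 w)\<close> falls off with \<open>\<bar>r\<bar>\<close>, in contrast to the uniform bound \<open>1 / (2 \<tau>)\<close> on the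
  second derivative.\<close>

lemma phi_quadratic_majorant:
  assumes "\<tau> > 0"
  shows "phi \<tau> (r + s) \<le> phi \<tau> r + (1 + r / sqrt (r\<^sup>2 + \<tau>\<^sup>2)) / 2 * s + s\<^sup>2 / (4 * sqrt (r\<^sup>2 + \<tau>\<^sup>2))"
proof -
  define w w' where "w = sqrt (r\<^sup>2 + \<tau>\<^sup>2)" and "w' = sqrt ((r + s)\<^sup>2 + \<tau>\<^sup>2)"
  have w: "0 < w" using assms sqrt_smoothing_bounds by (simp add: w_def)
  have sq: "w\<^sup>2 = r\<^sup>2 + \<tau>\<^sup>2" "w'\<^sup>2 = (r + s)\<^sup>2 + \<tau>\<^sup>2" by (simp_all add: w_def w'_def)
  have "0 \<le> (w' - w)\<^sup>2" by simp
  then have "2 * w * w' \<le> 2 * w\<^sup>2 + (w'\<^sup>2 - w\<^sup>2)"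
    by (simp add: power2_diff) (simp add: power2_eq_square algebra_simps)
  also have "\<dots> = 2 * w\<^sup>2 + 2 * r * s + s\<^sup>2" by (simp add: sq) (simp add: power2_eq_square algebra_simps)
  finally have "w' \<le> w + r / w * s + s\<^sup>2 / (2 * w)"
    using w by (simp add: field_simps power2_eq_square)
  then have "(r + s + w') / 2 \<le> (r + w) / 2 + (1 + r / w) / 2 * s + s\<^sup>2 / (4 * w)"
    by (simp add: algebra_simps add_divide_distrib)
  then show ?thesis by (simp add: phi_def flip: w_def w'_def)
qed

lemma phi_has_real_derivative:
  assumes "\<tau> > 0"
  shows "(phi \<tau> has_real_derivative (1 + r / sqrt (r\<^sup>2 + \<tau>\<^sup>2)) / 2) (at r)"
proof -
  have "r\<^sup>2 + \<tau>\<^sup>2 > 0" using assms by (simp add: add_nonneg_pos)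
  then have "((\<lambda>r. (r + sqrt (r\<^sup>2 + \<tau>\<^sup>2)) / 2) has_real_derivative (1 + r / sqrt (r\<^sup>2 + \<tau>\<^sup>2)) / 2) (at r)"
    by (auto intro!: derivative_eq_intros simp: field_simps)
  then show ?thesis by (simp add: phi_def[abs_def])
qed

lemma sum_UNIV_option:
  "(\<Sum>j\<in>(UNIV :: 'n::finite option set). h j) = h None + (\<Sum>i\<in>UNIV. h (Some i))"
  by (simp add: UNIV_option_conv sum.reindex)

lemma inner_join: "join x t \<bullet> z = x \<bullet> xpart z + t * tpart z"
  by (simp add: inner_vec_def sum_UNIV_option join_def xpart_def tpart_def)

lemma inner_xpart_tpart: "y \<bullet> z = xpart y \<bullet> xpart z + tpart y * tpart z"
  by (simp add: inner_vec_def sum_UNIV_option xpart_def tpart_def)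

lemma bounded_linear_xpart: "bounded_linear xpart"
  by (rule linear_conv_bounded_linear[THEN iffD1], rule linearI)
     (simp_all add: xpart_def vec_eq_iff)

lemma bounded_linear_tpart: "bounded_linear tpart"
  unfolding tpart_def by (rule bounded_linear_vec_nth)

lemma inner_J_mat: "J_mat f z $ i \<bullet> h = grad (f i) (xpart z) \<bullet> xpart h - tpart h"
  by (simp add: J_mat_def inner_join)

context
  fixes f :: "'m::finite \<Rightarrow> real ^ 'n::finite \<Rightarrow> real"
    and L :: "'m \<Rightarrow> real" and \<tau> \<delta> :: real
  assumes L: "\<And>i. L i \<ge> 0"
    and f: "\<And>i. C1_Lipschitz_grad (L i) (f i)"
    and tau: "\<tau> > 0" and delta: "\<delta> > 0"
begin

text \<open>The derivative of \<open>phi \<tau>\<close> at the residual \<open>f i x - t\<close>.\<close>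

definition phi_slope :: "real ^ 'n option \<Rightarrow> 'm \<Rightarrow> real" where
  "phi_slope z i = (1 + (f i (xpart z) - tpart z) / omega f \<tau> z i) / 2"

lemma omega_bounds: "\<tau> \<le> omega f \<tau> z i" "0 < omega f \<tau> z i"
  using sqrt_smoothing_bounds[OF tau] by (simp_all add: omega_def)

lemma GDERIV_Phi:
  "GDERIV (Phi f \<tau>) z :> join 0 1 + (\<Sum>i\<in>UNIV. phi_slope z i *\<^sub>R (J_mat f z $ i))"
proof -
  have r: "((\<lambda>z. f i (xpart z) - tpart z) has_derivative (\<lambda>h. J_mat f z $ i \<bullet> h)) (at z)" for i
  proof -
    have "(f i has_derivative (\<lambda>h. h \<bullet> grad (f i) (xpart z))) (at (xpart z))"
      using GDERIV_grad[of "f i"] f[of i] by (simp add: C1_Lipschitz_grad_def gderiv_def)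
    moreover have "(xpart has_derivative xpart) (at z)"
      by (rule bounded_linear_imp_has_derivative[OF bounded_linear_xpart])
    ultimately have "((\<lambda>z. f i (xpart z)) has_derivative (\<lambda>h. xpart h \<bullet> grad (f i) (xpart z))) (at z)"
      using has_derivative_compose by blast
    moreover have "(tpart has_derivative tpart) (at z)"
      by (rule bounded_linear_imp_has_derivative[OF bounded_linear_tpart])
    ultimately have "((\<lambda>z. f i (xpart z) - tpart z) has_derivative
        (\<lambda>h. xpart h \<bullet> grad (f i) (xpart z) - tpart h)) (at z)"
      by (rule has_derivative_diff)
    then show ?thesis by (simp add: inner_J_mat inner_commute[of "xpart _" "grad _ _"])
  qed
  have "((\<lambda>z. phi \<tau> (f i (xpart z) - tpart z)) has_derivative
      (\<lambda>h. phi_slope z i * (J_mat f z $ i \<bullet> h))) (at z)" for i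
    using has_derivative_compose[OF r[of i]
        phi_has_real_derivative[OF tau, unfolded has_field_derivative_def]]
    by (simp add: phi_slope_def omega_def)
  then have "(Phi f \<tau> has_derivative
      (\<lambda>h. tpart h + (\<Sum>i\<in>UNIV. phi_slope z i * (J_mat f z $ i \<bullet> h)))) (at z)"
    unfolding Phi_def[abs_def]
    by (intro has_derivative_add has_derivative_sum
        bounded_linear_imp_has_derivative[OF bounded_linear_tpart])
  then show ?thesis
    by (simp add: gderiv_def inner_add_right inner_sum_right inner_join inner_commute[of _ "join _ _"]
        inner_commute[of _ "J_mat _ _ $ _"])
qed

lemma inner_grad_Phi:
  "grad (Phi f \<tau>) z \<bullet> d = tpart d + (\<Sum>i\<in>UNIV. phi_slope z i * (J_mat f z $ i \<bullet> d))"
  by (simp add: grad_eqI[OF GDERIV_Phi] inner_add_left inner_sum_left inner_join)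

text \<open>The bilinear form of the metric: symmetry, positivity, the majorant and the bound on compact
  sets are all read off from this formula.\<close>

lemma inner_P_mat:
  "x \<bullet> (P_mat f L \<tau> \<delta> z *v y) = \<delta> * (x \<bullet> y) + (\<Sum>i\<in>UNIV. L i) * (xpart x \<bullet> xpart y)
     + 1/2 * (\<Sum>i\<in>UNIV. (J_mat f z $ i \<bullet> x) * (J_mat f z $ i \<bullet> y) / omega f \<tau> z i)"
proof -
  have diag: "diag_mat v *v w = (\<chi> i. v $ i * w $ i)" for v w :: "real ^ 'k::finite"
    by (simp add: vec_eq_iff diag_mat_def matrix_vector_mult_def if_distrib if_distribR sum.delta cong: if_cong)
  have "x \<bullet> (Pi_x *v y) = xpart x \<bullet> xpart y"
    by (simp add: Pi_x_def diag inner_vec_def sum_UNIV_option join_def xpart_def)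
  moreover have "x \<bullet> ((transpose (J_mat f z) ** D_mat f \<tau> z ** J_mat f z) *v y)
      = (D_mat f \<tau> z *v (J_mat f z *v y)) \<bullet> (J_mat f z *v x)"
    by (simp add: inner_commute[of x] dot_lmul_matrix flip: matrix_vector_mul_assoc)
  moreover have "\<dots> = (\<Sum>i\<in>UNIV. (J_mat f z $ i \<bullet> x) * (J_mat f z $ i \<bullet> y) / omega f \<tau> z i)"
    unfolding D_mat_def diag by (simp add: inner_vec_def[of "vec_lambda _"] matrix_vector_mul_component field_simps)
  ultimately show ?thesis
    by (simp add: P_mat_def matrix_vector_mult_add_rdistrib inner_add_right
        flip: scaleR_matrix_vector_assoc)
qed

lemma sym_pos_def_P_mat: "sym_pos_def (P_mat f L \<tau> \<delta> z)"
  unfolding sym_pos_def_def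
proof (intro conjI allI impI)
  fix x y
  show "x \<bullet> (P_mat f L \<tau> \<delta> z *v y) = y \<bullet> (P_mat f L \<tau> \<delta> z *v x)"
    by (simp add: inner_P_mat inner_commute[of x y] inner_commute[of "xpart x"] mult.commute)
next
  fix v :: "real ^ 'n option" assume "v \<noteq> 0"
  then have "0 < \<delta> * (v \<bullet> v)" using delta by simp
  moreover have "0 \<le> (\<Sum>i\<in>UNIV. L i) * (xpart v \<bullet> xpart v)"
    using L by (intro mult_nonneg_nonneg sum_nonneg) auto
  moreover have "0 \<le> (\<Sum>i\<in>UNIV. (J_mat f z $ i \<bullet> v) * (J_mat f z $ i \<bullet> v) / omega f \<tau> z i)"
    using omega_bounds(2)[THEN less_imp_le] by (intro sum_nonneg divide_nonneg_nonneg) auto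
  ultimately show "0 < v \<bullet> (P_mat f L \<tau> \<delta> z *v v)"
    unfolding inner_P_mat by linarith
qed

text \<open>Each summand is bounded in two steps: \<open>f i\<close> by its linearization plus
  \<open>L i / 2 * (p \<bullet> p)\<close>, an error that \<open>phi_le_add\<close> carries outside, and then \<open>phi \<tau>\<close>, at
  the linearized residual, by its parabola. The sum of the quadratic terms is half the energy of
  \<open>d\<close> without its \<open>\<delta>\<close> part.\<close>

lemma Phi_quadratic_majorant:
  "Phi f \<tau> (z + d) \<le> Phi f \<tau> z + grad (Phi f \<tau>) z \<bullet> d + 1/2 * (d \<bullet> (P_mat f L \<tau> \<delta> z *v d))"
proof -
  define p r s w where "p = xpart d" and "r i = f i (xpart z) - tpart z"
    and "s i = J_mat f z $ i \<bullet> d" and "w i = omega f \<tau> z i" for i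
  have add: "xpart (z + d) = xpart z + p" "tpart (z + d) = tpart z + tpart d"
    by (simp_all add: p_def xpart_def tpart_def vec_eq_iff)
  have "phi \<tau> (f i (xpart (z + d)) - tpart (z + d))
      \<le> phi \<tau> (r i) + phi_slope z i * s i + (s i)\<^sup>2 / (4 * w i) + L i / 2 * (p \<bullet> p)" for i
  proof -
    have "f i (xpart (z + d)) - tpart (z + d) \<le> (r i + s i) + L i / 2 * (p \<bullet> p)"
      using Lipschitz_grad_quadratic_upper_bound[OF f, of i "xpart z" p]
      by (simp add: add r_def s_def inner_J_mat flip: p_def)
    then have "phi \<tau> (f i (xpart (z + d)) - tpart (z + d)) \<le> phi \<tau> (r i + s i) + L i / 2 * (p \<bullet> p)"
      using L by (intro phi_le_add) auto
    also have "phi \<tau> (r i + s i) \<le> phi \<tau> (r i) + phi_slope z i * s i + (s i)\<^sup>2 / (4 * w i)"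
      using phi_quadratic_majorant[OF tau, of "r i" "s i"]
      by (simp add: phi_slope_def r_def w_def omega_def)
    finally show ?thesis by simp
  qed
  then have "Phi f \<tau> (z + d) \<le> tpart (z + d) + (\<Sum>i\<in>UNIV.
      phi \<tau> (r i) + phi_slope z i * s i + (s i)\<^sup>2 / (4 * w i) + L i / 2 * (p \<bullet> p))"
    unfolding Phi_def by (intro add_left_mono sum_mono)
  also have "\<dots> = Phi f \<tau> z + grad (Phi f \<tau>) z \<bullet> d
      + 1/2 * ((\<Sum>i\<in>UNIV. L i) * (p \<bullet> p) + 1/2 * (\<Sum>i\<in>UNIV. s i * s i / w i))"
    unfolding add by (simp add: Phi_def inner_grad_Phi sum.distrib sum_distrib_left sum_distrib_right power2_eq_square
        algebra_simps flip: r_def s_def)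
  also have "\<dots> \<le> Phi f \<tau> z + grad (Phi f \<tau>) z \<bullet> d + 1/2 * (d \<bullet> (P_mat f L \<tau> \<delta> z *v d))"
    using delta by (simp add: inner_P_mat flip: p_def s_def w_def)
  finally show ?thesis .
qed

lemma continuous_on_Phi: "continuous_on S (Phi f \<tau>)"
  using GDERIV_Phi
  by (auto simp: gderiv_def intro!: continuous_at_imp_continuous_on has_derivative_continuous)

text \<open>The rows of \<open>J_mat\<close> are continuous in \<open>z\<close>, hence bounded on \<open>S\<close>, and every \<open>omega\<close> is at
  least \<open>\<tau>\<close>.\<close>

lemma P_mat_bounded_on_compact:
  assumes "compact S"
  obtains M where "M > 0" "\<And>z v. z \<in> S \<Longrightarrow> v \<bullet> (P_mat f L \<tau> \<delta> z *v v) \<le> M * (v \<bullet> v)"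
proof -
  define N where "N z = (\<Sum>i\<in>UNIV. J_mat f z $ i \<bullet> J_mat f z $ i)" for z :: "real ^ 'n option"
  have "J_mat f z $ i \<bullet> J_mat f z $ i = grad (f i) (xpart z) \<bullet> grad (f i) (xpart z) + 1" for z i
    by (simp add: J_mat_def inner_join) (simp add: join_def xpart_def tpart_def)
  then have N: "N = (\<lambda>z. \<Sum>i\<in>UNIV. grad (f i) (xpart z) \<bullet> grad (f i) (xpart z) + 1)"
    by (simp add: N_def fun_eq_iff)
  have "continuous_on S (\<lambda>z. grad (f i) (xpart z))" for i
    using f[of i] linear_continuous_on[OF bounded_linear_xpart]
    by (intro continuous_on_compose2[of UNIV "grad (f i)" S xpart]) (auto simp: C1_Lipschitz_grad_def)
  then have "continuous_on S N" unfolding N by (intro continuous_intros)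
  then have "bounded (N ` S)" using assms by (intro compact_imp_bounded compact_continuous_image)
  then obtain C where C: "\<And>z. z \<in> S \<Longrightarrow> \<bar>N z\<bar> \<le> C" by (auto simp: bounded_iff)
  define M where "M = \<delta> + (\<Sum>i\<in>UNIV. L i) + \<bar>C\<bar> / (2 * \<tau>)"
  show thesis
  proof (rule that)
    show "M > 0" unfolding M_def using delta tau L
      by (intro add_pos_nonneg) (auto intro: sum_nonneg)
    fix z v assume z: "z \<in> S"
    have "(J_mat f z $ i \<bullet> v) * (J_mat f z $ i \<bullet> v) / omega f \<tau> z i
        \<le> (J_mat f z $ i \<bullet> J_mat f z $ i) * (v \<bullet> v) / \<tau>" for i
      using Cauchy_Schwarz_ineq[of "J_mat f z $ i" v] omega_bounds tau
      by (intro frac_le) (auto simp: power2_eq_square)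
    then have "(\<Sum>i\<in>UNIV. (J_mat f z $ i \<bullet> v) * (J_mat f z $ i \<bullet> v) / omega f \<tau> z i)
        \<le> N z * (v \<bullet> v) / \<tau>"
      unfolding N_def sum_distrib_right sum_divide_distrib by (rule sum_mono)
    also have "\<dots> \<le> \<bar>C\<bar> * (v \<bullet> v) / \<tau>"
      using C[OF z] tau by (intro divide_right_mono mult_right_mono) auto
    finally have J: "(\<Sum>i\<in>UNIV. (J_mat f z $ i \<bullet> v) * (J_mat f z $ i \<bullet> v) / omega f \<tau> z i)
        \<le> \<bar>C\<bar> * (v \<bullet> v) / \<tau>" .
    have "xpart v \<bullet> xpart v \<le> v \<bullet> v" by (simp add: inner_xpart_tpart[of v v])
    then have "(\<Sum>i\<in>UNIV. L i) * (xpart v \<bullet> xpart v) \<le> (\<Sum>i\<in>UNIV. L i) * (v \<bullet> v)"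
      using L by (intro mult_left_mono sum_nonneg) auto
    with J show "v \<bullet> (P_mat f L \<tau> \<delta> z *v v) \<le> M * (v \<bullet> v)"
      by (simp add: inner_P_mat M_def algebra_simps)
  qed
qed

end

section \<open>Armijo backtracking\<close>

text \<open>Along \<open>d\<close> the majorant exceeds the linear model by \<open>\<alpha>\<^sup>2 / 2\<close> times the energy of \<open>d\<close>, which by
  the descent hypothesis is at most \<open>\<alpha>\<^sup>2 / (2 \<sigma>)\<close> times the decrease rate. For
  \<open>\<alpha> \<le> 2 (1 - c\<^sub>1) \<sigma>\<close> this consumes at most the fraction \<open>1 - c\<^sub>1\<close> of the linear decrease.\<close>

lemma armijo_of_quadratic_majorant:
  assumes maj: "\<And>d. F (z + d) \<le> F z + grad F z \<bullet> d + 1/2 * (d \<bullet> (P *v d))"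
    and P: "sym_pos_def P"
    and desc: "\<sigma> * (d \<bullet> (P *v d)) \<le> - (grad F z \<bullet> d)"
    and c: "c\<^sub>1 < 1" and al: "0 < \<alpha>" "\<alpha> \<le> 2 * (1 - c\<^sub>1) * \<sigma>"
  shows "armijo F c\<^sub>1 z d \<alpha>"
proof -
  define E g where "E = d \<bullet> (P *v d)" and "g = grad F z \<bullet> d"
  have E: "0 \<le> E" unfolding E_def by (rule sym_pos_def_nonneg[OF P])
  have "\<alpha> * E \<le> 2 * (1 - c\<^sub>1) * \<sigma> * E" using al E by (intro mult_right_mono)
  also have "\<dots> = 2 * (1 - c\<^sub>1) * (\<sigma> * E)" by simp
  also have "\<dots> \<le> 2 * (1 - c\<^sub>1) * (- g)"
    using c desc by (intro mult_left_mono) (auto simp: E_def g_def)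
  finally have "\<alpha> * (\<alpha> * E) \<le> \<alpha> * (2 * (1 - c\<^sub>1) * (- g))" using al by (intro mult_left_mono) auto
  moreover have "F (z + \<alpha> *\<^sub>R d) \<le> F z + \<alpha> * g + 1/2 * (\<alpha> * (\<alpha> * E))"
    using maj[of "\<alpha> *\<^sub>R d"] by (simp add: E_def g_def matrix_vector_mult_scaleR)
  ultimately show ?thesis by (simp add: armijo_def g_def[symmetric] algebra_simps)
qed

text \<open>If trial step \<open>j > 0\<close> is the first accepted one, then \<open>\<rho> ^ (j - 1)\<close> was rejected, so it
  exceeds \<open>s\<close>.\<close>

lemma backtracking_step_exists_and_bounded:
  assumes arm: "\<And>\<alpha>. 0 < \<alpha> \<Longrightarrow> \<alpha> \<le> s \<Longrightarrow> armijo F c\<^sub>1 z d \<alpha>" and s: "0 < s"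
    and rho: "0 < \<rho>" "\<rho> < 1"
  shows "\<exists>\<alpha>. backtracking_step F c\<^sub>1 \<rho> z d \<alpha>"
    and "backtracking_step F c\<^sub>1 \<rho> z d \<alpha> \<Longrightarrow> \<rho> * min 1 s \<le> \<alpha>"
proof -
  obtain n where "\<rho> ^ n < s" using real_arch_pow_inv[OF s rho(2)] by blast
  then have "armijo F c\<^sub>1 z d (\<rho> ^ n)" using rho by (intro arm) auto
  then have "\<exists>j. armijo F c\<^sub>1 z d (\<rho> ^ j) \<and> (\<forall>i<j. \<not> armijo F c\<^sub>1 z d (\<rho> ^ i))"
    by (rule exists_least_iff[THEN iffD1, OF exI])
  then show "\<exists>\<alpha>. backtracking_step F c\<^sub>1 \<rho> z d \<alpha>"
    unfolding backtracking_step_def by blast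
  assume "backtracking_step F c\<^sub>1 \<rho> z d \<alpha>"
  then obtain j where j: "\<alpha> = \<rho> ^ j" "\<And>i. i < j \<Longrightarrow> \<not> armijo F c\<^sub>1 z d (\<rho> ^ i)"
    unfolding backtracking_step_def by blast
  show "\<rho> * min 1 s \<le> \<alpha>"
  proof (cases j)
    case 0
    have "\<rho> * min 1 s \<le> 1 * 1" using rho s by (intro mult_mono) auto
    then show ?thesis using j(1) 0 by simp
  next
    case (Suc i)
    then have "\<not> \<rho> ^ i \<le> s" using arm[of "\<rho> ^ i"] j(2)[of i] rho by auto
    then show ?thesis using j(1) Suc rho by simp
  qed
qed

text \<open>The values of \<open>F\<close> are decreasing and bounded below, hence convergent, so their decrements tend
  to zero; by the Armijo condition and the lower bound on the steps the decrements dominate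
  \<open>- grad F (z k) \<bullet> d k\<close>, and by the angle condition also the squared gradient norm.\<close>

lemma armijo_descent_gradient_tendsto_0:
  fixes F :: "'a::real_inner \<Rightarrow> real"
  assumes arm: "\<And>k. armijo F c\<^sub>1 (z k) (d k) (\<alpha> k)" and step: "\<And>k. z (Suc k) = z k + \<alpha> k *\<^sub>R d k"
    and c: "0 < c\<^sub>1" and s: "0 < s" "\<And>k. s \<le> \<alpha> k" and M: "0 < M"
    and angle: "\<And>k. (norm (grad F (z k)))\<^sup>2 \<le> M * (- (grad F (z k) \<bullet> d k))"
    and bdd: "\<And>k. m \<le> F (z k)"
  shows "(\<lambda>k. norm (grad F (z k))) \<longlonglongrightarrow> 0"
proof -
  define q where "q k = - (grad F (z k) \<bullet> d k)" for k
  have q: "0 \<le> q k" for k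
  proof -
    have "0 \<le> M * q k" using order_trans[OF zero_le_power2 angle[of k]] by (simp only: q_def)
    then show ?thesis using M by (simp add: zero_le_mult_iff)
  qed
  have decrease: "c\<^sub>1 * s * q k \<le> F (z k) - F (z (Suc k))" for k
  proof -
    have "c\<^sub>1 * s * q k \<le> c\<^sub>1 * \<alpha> k * q k"
      using c s q by (intro mult_right_mono mult_left_mono) auto
    also have "\<dots> \<le> F (z k) - F (z (Suc k))"
      using arm[of k] by (simp add: armijo_def step q_def)
    finally show ?thesis .
  qed
  have "decseq (\<lambda>k. F (z k))"
  proof (rule decseq_SucI)
    fix k
    have "0 \<le> c\<^sub>1 * s * q k" using c s q by simp
    then show "F (z (Suc k)) \<le> F (z k)" using decrease[of k] by linarith
  qed
  then obtain l where l: "(\<lambda>k. F (z k)) \<longlonglongrightarrow> l"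
    using decseq_convergent bdd by metis
  have "(\<lambda>k. M / (c\<^sub>1 * s) * (F (z k) - F (z (Suc k)))) \<longlonglongrightarrow> M / (c\<^sub>1 * s) * (l - l)"
    by (intro tendsto_intros l LIMSEQ_Suc[OF l])
  then have lim: "(\<lambda>k. M / (c\<^sub>1 * s) * (F (z k) - F (z (Suc k)))) \<longlonglongrightarrow> 0" by simp
  have "(norm (grad F (z k)))\<^sup>2 \<le> M / (c\<^sub>1 * s) * (F (z k) - F (z (Suc k)))" for k
  proof -
    have "(norm (grad F (z k)))\<^sup>2 \<le> M / (c\<^sub>1 * s) * (c\<^sub>1 * s * q k)"
      using angle[of k] c s by (simp add: q_def)
    also have "\<dots> \<le> M / (c\<^sub>1 * s) * (F (z k) - F (z (Suc k)))"
      using M c s by (intro mult_left_mono decrease) auto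
    finally show ?thesis .
  qed
  then have "(\<lambda>k. (norm (grad F (z k)))\<^sup>2) \<longlonglongrightarrow> 0"
    by (intro tendsto_sandwich[OF _ _ tendsto_const lim]) auto
  then have "(\<lambda>k. sqrt ((norm (grad F (z k)))\<^sup>2)) \<longlonglongrightarrow> sqrt 0" by (rule tendsto_real_sqrt)
  then show ?thesis by simp
qed

section \<open>Descent and convergence of the method\<close>

lemma Gamma0_inverse: "1 < \<theta> \<Longrightarrow> (1 - 1 / \<theta>\<^sup>2) * Gamma0 \<theta> = 1"
  by (simp add: Gamma0_def field_simps)

text \<open>The factor \<open>1 - 1 / \<theta>\<^sup>2\<close> is the reciprocal of \<open>Gamma0 \<theta>\<close>, so a bound on the energy by
  \<open>Gamma0 \<theta> * G\<close> turns into descent in proportion to the energy.\<close>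

lemma descent_of_energy_bound:
  assumes th: "\<theta> > 1" and bound: "d \<bullet> (P *v d) \<le> Gamma0 \<theta> * G" and G: "G \<le> q"
  shows "(1 - 1 / \<theta>\<^sup>2) * (d \<bullet> (P *v d)) \<le> q"
proof -
  have pos: "0 < 1 - 1 / \<theta>\<^sup>2" using th by (simp add: one_less_power)
  then have "(1 - 1 / \<theta>\<^sup>2) * (d \<bullet> (P *v d)) \<le> (1 - 1 / \<theta>\<^sup>2) * (Gamma0 \<theta> * G)"
    using bound by (intro mult_left_mono) auto
  also have "\<dots> = G" using Gamma0_inverse[OF th] by (simp flip: mult.assoc)
  finally show ?thesis using G by simp
qed

lemma search_dir_slope:
  assumes P: "sym_pos_def P" and mu: "0 \<le> \<mu>"
  shows "g \<bullet> (matrix_inv P *v g) \<le> - (g \<bullet> search_dir \<theta> \<mu> P g a b)"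
  using mu sym_pos_def_nonneg[OF P, of a] by (simp add: grad_inner_search_dir A_of_def)

lemma search_dir_descent:
  assumes P: "sym_pos_def P" and "a \<noteq> 0" "b \<noteq> 0" and th: "\<theta> > 1"
    and mu: "0 \<le> \<mu>" "\<mu> \<le> mu_star \<theta> P a b" and d: "d = search_dir \<theta> \<mu> P g a b"
  shows "(1 - 1 / \<theta>\<^sup>2) * (d \<bullet> (P *v d)) \<le> - (g \<bullet> d)"
  using descent_of_energy_bound[OF th search_dir_energy_bound[OF assms]]
    search_dir_slope[OF P mu(1)] d by simp

text \<open>A restart direction has energy equal to its decrease rate \<open>- (g \<bullet> d)\<close>, so it satisfies the two inequalities that
  the convergence argument uses about directions of the general form.\<close>

lemma restart_dir_descent:
  assumes P: "sym_pos_def P" and th: "\<theta> > 1" and d: "d = restart_dir P g"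
  shows "g \<bullet> (matrix_inv P *v g) \<le> - (g \<bullet> d)"
    and "(1 - 1 / \<theta>\<^sup>2) * (d \<bullet> (P *v d)) \<le> - (g \<bullet> d)"
proof -
  show slope: "g \<bullet> (matrix_inv P *v g) \<le> - (g \<bullet> d)" by (simp add: d restart_dir_def)
  have energy: "d \<bullet> (P *v d) = - (g \<bullet> d)"
    by (simp add: d restart_dir_def matrix_vector_mult_uminus sym_pos_def_matrix_inv[OF P] inner_commute)
  have "0 \<le> d \<bullet> (P *v d)" by (rule sym_pos_def_nonneg[OF P])
  moreover have "0 \<le> 1 / \<theta>\<^sup>2" by simp
  ultimately have "(1 - 1 / \<theta>\<^sup>2) * (d \<bullet> (P *v d)) \<le> 1 * (d \<bullet> (P *v d))"
    by (intro mult_right_mono) auto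
  then show "(1 - 1 / \<theta>\<^sup>2) * (d \<bullet> (P *v d)) \<le> - (g \<bullet> d)" by (simp add: energy)
qed

theorem theorem12p3:
  fixes f :: "'m::finite \<Rightarrow> real ^ 'n::finite \<Rightarrow> real"
    and L :: "'m \<Rightarrow> real"
    and \<tau> \<delta> \<theta> :: real
  assumes "\<And>i. L i \<ge> 0"
    and "\<And>i. C1_Lipschitz_grad (L i) (f i)"
    and "\<tau> > 0" and "\<delta> > 0" and "\<theta> > 1"
  shows
    "(\<forall>(z :: real ^ 'n option) a b \<mu>. a \<noteq> 0 \<and> b \<noteq> 0 \<and> \<mu> \<ge> 0 \<longrightarrow>
       (let g = grad (Phi f \<tau>) z;
            P = P_mat f L \<tau> \<delta> z;
            d = search_dir \<theta> \<mu> P g a b;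
            bt = b_tilde \<theta> P a b
        in
          \<comment> \<open>(a)\<close>
          (calD \<theta> P a b \<ge> (\<theta> - 1) * sqrt (A_of P a * B_of P b) \<and>
           (\<theta> - 1) * sqrt (A_of P a * B_of P b) > 0) \<and>
          \<comment> \<open>(b)\<close>
          g \<bullet> d = - (g \<bullet> (matrix_inv P *v g)) - \<mu> * ((g \<bullet> a)\<^sup>2 / A_of P a) \<and>
          \<comment> \<open>(c)\<close>
          (d \<bullet> bt = - Theta \<theta> \<mu> P a b * (g \<bullet> a) \<and> Theta \<theta> \<mu> P a b > 0) \<and>
          \<comment> \<open>(d)\<close>
          (\<mu> \<le> mu_star \<theta> P a b \<longrightarrow>
             d \<bullet> (P *v d) \<le> Gamma0 \<theta> * (g \<bullet> (matrix_inv P *v g)) \<and>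
             - (g \<bullet> d) \<ge> (1 - 1 / \<theta>\<^sup>2) * (d \<bullet> (P *v d))) \<and>
          \<comment> \<open>(e), Armijo steps and backtracking\<close>
          (\<forall>c\<^sub>1 \<rho>. 0 < c\<^sub>1 \<and> c\<^sub>1 < 1 \<and> 0 < \<rho> \<and> \<rho> < 1 \<and> \<mu> \<le> mu_star \<theta> P a b \<longrightarrow>
             (\<forall>\<alpha>. 0 < \<alpha> \<and> \<alpha> \<le> 2 * (1 - c\<^sub>1) * (1 - 1 / \<theta>\<^sup>2) \<longrightarrow> armijo (Phi f \<tau>) c\<^sub>1 z d \<alpha>) \<and>
             (\<exists>\<alpha>. backtracking_step (Phi f \<tau>) c\<^sub>1 \<rho> z d \<alpha>) \<and>
             (\<forall>\<alpha>. backtracking_step (Phi f \<tau>) c\<^sub>1 \<rho> z d \<alpha> \<longrightarrow>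
                \<alpha> \<ge> \<rho> * min 1 (2 * (1 - c\<^sub>1) * (1 - 1 / \<theta>\<^sup>2)))))) \<and>
     \<comment> \<open>(e), convergence\<close>
     (\<forall>c\<^sub>1 \<rho> (z :: nat \<Rightarrow> real ^ 'n option) d \<alpha>.
        0 < c\<^sub>1 \<and> c\<^sub>1 < 1 \<and> 0 < \<rho> \<and> \<rho> < 1 \<and>
        compact {y. Phi f \<tau> y \<le> Phi f \<tau> (z 0)} \<and>
        (\<forall>k. grad (Phi f \<tau>) (z k) \<noteq> 0) \<and>
        (\<forall>k. z (Suc k) = z k + \<alpha> k *\<^sub>R d k) \<and>
        (\<forall>k. backtracking_step (Phi f \<tau>) c\<^sub>1 \<rho> (z k) (d k) (\<alpha> k)) \<and>
        d 0 = restart_dir (P_mat f L \<tau> \<delta> (z 0)) (grad (Phi f \<tau>) (z 0)) \<and>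
        (\<forall>k. d k = restart_dir (P_mat f L \<tau> \<delta> (z k)) (grad (Phi f \<tau>) (z k)) \<or>
             (\<exists>a b \<mu>. a \<noteq> 0 \<and> b \<noteq> 0 \<and> 0 \<le> \<mu> \<and>
                \<mu> \<le> mu_star \<theta> (P_mat f L \<tau> \<delta> (z k)) a b \<and>
                d k = search_dir \<theta> \<mu> (P_mat f L \<tau> \<delta> (z k)) (grad (Phi f \<tau>) (z k)) a b)) \<longrightarrow>
        (\<lambda>k. norm (grad (Phi f \<tau>) (z k))) \<longlonglongrightarrow> 0)"
proof -
  let ?F = "Phi f \<tau>" and ?g = "grad (Phi f \<tau>)" and ?P = "P_mat f L \<tau> \<delta>"
  define \<sigma> where "\<sigma> = 1 - 1 / \<theta>\<^sup>2"
  note th = \<open>\<theta> > 1\<close>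
  have sigma: "0 < \<sigma>" using th by (simp add: \<sigma>_def one_less_power)
  have P: "sym_pos_def (?P z)" for z
    by (rule sym_pos_def_P_mat[of L f \<tau> \<delta> z]) (use assms in auto)
  have armijo: "armijo ?F c\<^sub>1 z d \<alpha>"
    if "\<sigma> * (d \<bullet> (?P z *v d)) \<le> - (?g z \<bullet> d)" "c\<^sub>1 < 1" "0 < \<alpha>" "\<alpha> \<le> 2 * (1 - c\<^sub>1) * \<sigma>"
    for c\<^sub>1 z d \<alpha>
    by (rule armijo_of_quadratic_majorant[OF _ P that])
       (rule Phi_quadratic_majorant[of L f \<tau> \<delta>], use assms in auto)
  show ?thesis
    unfolding Let_def \<sigma>_def[symmetric]
  proof (intro conjI allI impI; (elim conjE)?)
    fix z a b :: "real ^ 'n option" and \<mu> :: real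
    assume a: "a \<noteq> 0" and b: "b \<noteq> 0" and mu: "0 \<le> \<mu>"
    let ?d = "search_dir \<theta> \<mu> (?P z) (?g z) a b"
    show "(\<theta> - 1) * sqrt (A_of (?P z) a * B_of (?P z) b) \<le> calD \<theta> (?P z) a b"
      and "0 < (\<theta> - 1) * sqrt (A_of (?P z) a * B_of (?P z) b)"
      using calD_lower_bound[OF P a b th] by auto
    show "?g z \<bullet> ?d = - (?g z \<bullet> (matrix_inv (?P z) *v ?g z)) - \<mu> * ((?g z \<bullet> a)\<^sup>2 / A_of (?P z) a)"
      by (rule grad_inner_search_dir)
    show "?d \<bullet> b_tilde \<theta> (?P z) a b = - Theta \<theta> \<mu> (?P z) a b * (?g z \<bullet> a)"
      and "0 < Theta \<theta> \<mu> (?P z) a b"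
      using search_dir_quasi_conjugacy[OF P a b th mu] by auto
    {
      assume mu': "\<mu> \<le> mu_star \<theta> (?P z) a b"
      show "?d \<bullet> (?P z *v ?d) \<le> Gamma0 \<theta> * (?g z \<bullet> (matrix_inv (?P z) *v ?g z))"
        by (rule search_dir_energy_bound[OF P a b th mu mu' refl])
      show desc: "\<sigma> * (?d \<bullet> (?P z *v ?d)) \<le> - (?g z \<bullet> ?d)"
        unfolding \<sigma>_def by (rule search_dir_descent[OF P a b th mu mu' refl])
      fix c\<^sub>1 \<rho> :: real assume c: "0 < c\<^sub>1" "c\<^sub>1 < 1" and rho: "0 < \<rho>" "\<rho> < 1"
      show arm: "armijo ?F c\<^sub>1 z ?d \<alpha>" if "0 < \<alpha>" "\<alpha> \<le> 2 * (1 - c\<^sub>1) * \<sigma>" for \<alpha>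
        using armijo[OF desc] c that by blast
      have s: "0 < 2 * (1 - c\<^sub>1) * \<sigma>" using c sigma by simp
      show "\<exists>\<alpha>. backtracking_step ?F c\<^sub>1 \<rho> z ?d \<alpha>"
        by (rule backtracking_step_exists_and_bounded(1)[OF arm s rho])
      show "\<rho> * min 1 (2 * (1 - c\<^sub>1) * \<sigma>) \<le> \<alpha>" if "backtracking_step ?F c\<^sub>1 \<rho> z ?d \<alpha>" for \<alpha>
        by (rule backtracking_step_exists_and_bounded(2)[OF arm s rho that])
    }
  next
    fix c\<^sub>1 \<rho> :: real and z d :: "nat \<Rightarrow> real ^ 'n option" and \<alpha> :: "nat \<Rightarrow> real"
    assume c: "0 < c\<^sub>1" "c\<^sub>1 < 1" and rho: "0 < \<rho>" "\<rho> < 1"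
      and compact: "compact {y. ?F y \<le> ?F (z 0)}"
      and step: "\<forall>k. z (Suc k) = z k + \<alpha> k *\<^sub>R d k"
      and bstep: "\<forall>k. backtracking_step ?F c\<^sub>1 \<rho> (z k) (d k) (\<alpha> k)"
      and dir: "\<forall>k. d k = restart_dir (?P (z k)) (?g (z k)) \<or>
             (\<exists>a b \<mu>. a \<noteq> 0 \<and> b \<noteq> 0 \<and> 0 \<le> \<mu> \<and> \<mu> \<le> mu_star \<theta> (?P (z k)) a b \<and>
                d k = search_dir \<theta> \<mu> (?P (z k)) (?g (z k)) a b)"
    have slope: "?g (z k) \<bullet> (matrix_inv (?P (z k)) *v ?g (z k)) \<le> - (?g (z k) \<bullet> d k)"
      and desc: "\<sigma> * (d k \<bullet> (?P (z k) *v d k)) \<le> - (?g (z k) \<bullet> d k)" for k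
      using dir[rule_format, of k] restart_dir_descent[OF P th] search_dir_slope[OF P]
        search_dir_descent[OF P _ _ th] unfolding \<sigma>_def by metis+
    define s where "s = 2 * (1 - c\<^sub>1) * \<sigma>"
    have s: "0 < s" using c sigma by (simp add: s_def)
    have alpha: "\<rho> * min 1 s \<le> \<alpha> k" for k
      by (rule backtracking_step_exists_and_bounded(2)[OF _ s rho bstep[rule_format, of k]])
         (use armijo[OF desc] c in \<open>simp add: s_def\<close>)
    have arm: "armijo ?F c\<^sub>1 (z k) (d k) (\<alpha> k)" for k
      using bstep[rule_format, of k] by (auto simp: backtracking_step_def)
    have smin: "0 < \<rho> * min 1 s" using rho s by simp
    \<comment> \<open>The iterates stay in the sublevel set, on which \<open>?F\<close> is bounded below and \<open>?P\<close> above.\<close>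
    have level: "z k \<in> {y. ?F y \<le> ?F (z 0)}" for k
    proof (induction k)
      case (Suc k)
      have "0 \<le> \<sigma> * (d k \<bullet> (?P (z k) *v d k))"
        using sigma sym_pos_def_nonneg[OF P] by simp
      then have "0 \<le> c\<^sub>1 * \<alpha> k * - (?g (z k) \<bullet> d k)"
        using c smin alpha[of k] desc[of k] by (intro mult_nonneg_nonneg) linarith+
      then have "?F (z (Suc k)) \<le> ?F (z k)"
        using arm[of k] step by (simp add: armijo_def)
      with Suc show ?case by simp
    qed simp
    have "continuous_on {y. ?F y \<le> ?F (z 0)} ?F"
      by (rule continuous_on_Phi[of L]) (use assms in auto)
    from continuous_attains_inf[OF compact _ this] level
    obtain y where y: "\<And>k. ?F y \<le> ?F (z k)" by blast
    obtain M where M: "M > 0"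
      "\<And>y v. y \<in> {y. ?F y \<le> ?F (z 0)} \<Longrightarrow> v \<bullet> (?P y *v v) \<le> M * (v \<bullet> v)"
      by (rule P_mat_bounded_on_compact[of L f \<tau> \<delta>, OF _ _ _ _ compact]) (use assms in auto)
    show "(\<lambda>k. norm (?g (z k))) \<longlonglongrightarrow> 0"
    proof (rule armijo_descent_gradient_tendsto_0[OF arm _ c(1) smin alpha M(1) _ y])
      fix k
      show "z (Suc k) = z k + \<alpha> k *\<^sub>R d k" using step by blast
      have "?g (z k) \<bullet> ?g (z k) \<le> M * (?g (z k) \<bullet> (matrix_inv (?P (z k)) *v ?g (z k)))"
        by (rule sym_pos_def_inv_lower_bound[OF P M(2)[OF level]])
      also have "\<dots> \<le> M * (- (?g (z k) \<bullet> d k))" using M(1) slope by (intro mult_left_mono) auto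
      finally show "(norm (?g (z k)))\<^sup>2 \<le> M * (- (?g (z k) \<bullet> d k))"
        by (simp add: power2_norm_eq_inner)
    qed
  qed
qed

end
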